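(* For all integers $m,n\ge 9$ with $m\equiv n\equiv 1\pmod 4$, there exists a Heffter array $H(m,n)$.
   Context: A (tight) Heffter array $H(m,n)$ is an $m\times n$ array with every cell filled by an element of $\mathbb{Z}_{2mn+1}$ such that every row and every column sums to $0$ modulo $2mn+1$, and no element of any pair $\{x,-x\}$ appears twice (using representatives $-mn,\dots,mn$, entries are nonzero and each of $1,\dots,mn$ appears exactly once up to sign). *)

theory Defs
  imports Main "HOL-Number_Theory.Cong"
begin

text \<open>
  Only the cells \<open>i < m\<close>, \<open>j < n\<close> of \<open>A\<close> are relevant. An element of the ring of integers modulo
  \<open>2mn + 1\<close> is represented by its unique representative in \<open>{-mn..mn}\<close>, so that the pair
  \<open>{x, -x}\<close> of residues corresponds to the integers of absolute value \<open>\<bar>x\<bar>\<close>.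
\<close>

definition heffter_array :: "nat \<Rightarrow> nat \<Rightarrow> (nat \<Rightarrow> nat \<Rightarrow> int) \<Rightarrow> bool" where
  "heffter_array m n A \<longleftrightarrow>
     (\<forall>i<m. \<forall>j<n. A i j \<in> {- int (m * n)..int (m * n)} \<and> A i j \<noteq> 0) \<and>
     (\<forall>i<m. [(\<Sum>j<n. A i j) = 0] (mod int (2 * m * n + 1))) \<and>
     (\<forall>j<n. [(\<Sum>i<m. A i j) = 0] (mod int (2 * m * n + 1))) \<and>
     (\<forall>x \<in> {1..int (m * n)}.
        \<exists>!c. c \<in> {..<m} \<times> {..<n} \<and> A (fst c) (snd c) \<in> {x, - x})"

end

theory Submission
  imports Defs
begin

text \<open>
  Write \<open>m = 5 + 4 * a\<close>, \<open>n = 5 + 4 * b\<close>, \<open>N = a + b\<close>, \<open>T = m * n = 25 + 20 * N + 16 * a * b\<close>, and cut the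
  array into a \<open>5 \<times> 5\<close> corner, \<open>N\<close> blocks of shape \<open>5 \<times> 4\<close> (\<open>a\<close> of them transposed) and \<open>a * b\<close> blocks
  of shape \<open>4 \<times> 4\<close>. All lines of all blocks sum to zero, except that one row and one column of the
  corner sum to \<open>- (2 * T + 1)\<close>.

  A \<open>4 \<times> 4\<close> block may use any 16 consecutive absolute values, because its signs balance in each line.
  A column of a \<open>5 \<times> 4\<close> block has odd length, so its signs do not balance: it consists of a small value
  \<open>6 + 4 * k + c\<close>, of a pair \<open>z - 1 - t\<close>, \<open>z + 4 + t\<close> (\<open>t = 2 * k\<close> or \<open>t = 2 * k + 1\<close>) lying symmetrically
  around a gap \<open>z, z + 1, z + 2, z + 3\<close>, whose difference makes up for the growth of the small value
  with the block number \<open>k\<close>, and of two values out of 8 consecutive ones that correct the remaining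
  bounded error. There are two such gaps, at \<open>z\<^sub>1\<close> and \<open>z\<^sub>2\<close>. The corner uses
  the values \<open>1, \<dots>, 5\<close>, the two gaps, and \<open>T - 11, \<dots>, T\<close>.

  Once every value \<open>1, \<dots>, T\<close> is known to occur, counting shows that it occurs only once.
\<close>

section \<open>The three kinds of blocks\<close>

text \<open>\<open>z1\<close> and \<open>z2\<close> cancel in every row and column, and
  \<open>T\<close> cancels except in row 2 and column 2, where -2 * \<open>T\<close> survives; hence
  one pattern serves all sizes.\<close>

definition corner :: "int \<Rightarrow> int \<Rightarrow> int \<Rightarrow> int list list" where
  "corner z1 z2 T =
    [[T - 1, T - 9, - (T - 2), - (T - 5), 3],
     [T - 8, 4, - (T - 7), z2, - (z2 + 3)],
     [- 5, - (T - 3), - T, - (z2 + 1), z2 + 2],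
     [- (T - 4), z1 + 3, 1, T - 6, - (z1 + 2)],
     [- (T - 10), - (z1 + 1), T - 11, 2, z1]]"

text \<open>In rows 0 to 2 the terms in \<open>k\<close> cancel down each column, leaving the errors
  1, -2, -1, 2; rows 3 and 4 contribute -1, 2, 1, -2.\<close>

definition strip :: "int \<Rightarrow> int \<Rightarrow> int \<Rightarrow> int \<Rightarrow> int list list" where
  "strip z1 z2 q k =
    [[6 + 4 * k, - (7 + 4 * k), - (8 + 4 * k), 9 + 4 * k],
     [z1 - 1 - 2 * k, - (z2 - 1 - 2 * k), - (z1 - 2 - 2 * k), z2 - 2 - 2 * k],
     [- (z1 + 4 + 2 * k), z2 + 4 + 2 * k, z1 + 5 + 2 * k, - (z2 + 5 + 2 * k)],
     [q + 8 * k, - (q + 8 * k + 2), q + 8 * k + 7, - (q + 8 * k + 5)],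
     [- (q + 8 * k + 1), q + 8 * k + 4, - (q + 8 * k + 6), q + 8 * k + 3]]"

definition square :: "int \<Rightarrow> int list list" where
  "square r =
    [[r, - (r + 1), - (r + 2), r + 3],
     [- (r + 4), r + 5, r + 6, - (r + 7)],
     [- (r + 8), r + 9, r + 10, - (r + 11)],
     [r + 12, - (r + 13), - (r + 14), r + 15]]"

text \<open>There are as many cells as values to be hit, so covering all of them makes the absolute
  value a bijection from the cells, which yields both the range and the uniqueness.\<close>

lemma heffter_arrayI:
  assumes surj: "{1..int (m * n)} \<subseteq> (\<lambda>(i, j). \<bar>A i j\<bar>) ` ({..<m} \<times> {..<n})"
    and row: "\<And>i. i < m \<Longrightarrow> [(\<Sum>j<n. A i j) = 0] (mod int (2 * m * n + 1))"
    and col: "\<And>j. j < n \<Longrightarrow> [(\<Sum>i<m. A i j) = 0] (mod int (2 * m * n + 1))"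
  shows "heffter_array m n A"
proof -
  let ?C = "{..<m} \<times> {..<n}" and ?f = "\<lambda>(i, j). \<bar>A i j\<bar>"
  have "card (?f ` ?C) \<le> card {1..int (m * n)}"
    using card_image_le[of ?C ?f] by (simp add: card_cartesian_product flip: of_nat_mult)
  then have img: "?f ` ?C = {1..int (m * n)}"
    using surj card_seteq[of "?f ` ?C" "{1..int (m * n)}"] by simp
  have inj: "inj_on ?f ?C"
    by (rule eq_card_imp_inj_on) (simp_all add: img card_cartesian_product flip: of_nat_mult)
  have rng: "\<bar>A i j\<bar> \<in> {1..int (m * n)}" if "i < m" "j < n" for i j
    using that img by force
  have abs_iff: "(A (fst c) (snd c) \<in> {x, - x}) = (?f c = x)" if "x > 0" for c x
    using that by (cases c) auto
  have ex1: "\<exists>!c. c \<in> ?C \<and> A (fst c) (snd c) \<in> {x, - x}" if x: "x \<in> {1..int (m * n)}" for x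
  proof -
    obtain c where c: "c \<in> ?C" "?f c = x" using x img by (metis (no_types, lifting) imageE)
    have pos: "x > 0" using x by simp
    show ?thesis
    proof (rule ex1I[of _ c])
      show "c \<in> ?C \<and> A (fst c) (snd c) \<in> {x, - x}"
        using c abs_iff[OF pos] by blast
      fix d assume "d \<in> ?C \<and> A (fst d) (snd d) \<in> {x, - x}"
      then have "d \<in> ?C" "?f d = ?f c" using c abs_iff[OF pos, of d] by (simp_all only:)
      then show "d = c" using inj_onD[OF inj] c(1) by blast
    qed
  qed
  have bounds: "A i j \<in> {- int (m * n)..int (m * n)} \<and> A i j \<noteq> 0" if "i < m" "j < n" for i j
    using rng[OF that] by auto
  show ?thesis
    unfolding heffter_array_def
    by (intro conjI allI impI ballI row col ex1 bounds[THEN conjunct1] bounds[THEN conjunct2])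
qed

section \<open>Line sums of the blocks\<close>

lemma sum_corner_blocks:
  fixes f :: "nat \<Rightarrow> int"
  shows "(\<Sum>j<5 + 4 * b. f j) = (\<Sum>j<5. f j) + (\<Sum>k<b. \<Sum>c<4. f (5 + 4 * k + c))"
proof (induction b)
  case (Suc b)
  have "5 + 4 * Suc b = Suc (Suc (Suc (Suc (5 + 4 * b))))" by simp
  then show ?case
    using Suc by (simp add: lessThan_Suc eval_nat_numeral)
qed simp

lemma less_4_cases: "c < (4::nat) \<Longrightarrow> c = 0 \<or> c = 1 \<or> c = 2 \<or> c = 3"
  by auto

lemma less_5_cases: "c < (5::nat) \<Longrightarrow> c = 0 \<or> c = 1 \<or> c = 2 \<or> c = 3 \<or> c = 4"
  by auto

lemma sum_less_4: "(\<Sum>c<(4::nat). f c) = f 0 + f 1 + f 2 + (f 3 :: int)"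
  by (simp add: eval_nat_numeral)

lemma sum_less_5: "(\<Sum>c<(5::nat). f c) = f 0 + f 1 + f 2 + f 3 + (f 4 :: int)"
  by (simp add: eval_nat_numeral)

lemma strip_row_sum: "i < 5 \<Longrightarrow> (\<Sum>c<4. strip z1 z2 q k ! i ! c) = 0"
  by (drule less_5_cases) (auto simp: sum_less_4 strip_def)

lemma strip_column_sum: "c < 4 \<Longrightarrow> (\<Sum>i<5. strip z1 z2 q k ! i ! c) = 0"
  by (drule less_4_cases) (auto simp: sum_less_5 strip_def)

lemma square_row_sum: "i < 4 \<Longrightarrow> (\<Sum>c<4. square r ! i ! c) = 0"
  by (drule less_4_cases) (auto simp: sum_less_4 square_def)

lemma square_column_sum: "c < 4 \<Longrightarrow> (\<Sum>i<4. square r ! i ! c) = 0"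
  by (drule less_4_cases) (auto simp: sum_less_4 square_def)

lemma corner_row_sum:
  "i < 5 \<Longrightarrow> (\<Sum>j<5. corner z1 z2 T ! i ! j) = (if i = 2 then - (2 * T + 1) else 0)"
  by (drule less_5_cases) (auto simp: sum_less_5 corner_def)

lemma corner_column_sum:
  "j < 5 \<Longrightarrow> (\<Sum>i<5. corner z1 z2 T ! i ! j) = (if j = 2 then - (2 * T + 1) else 0)"
  by (drule less_5_cases) (auto simp: sum_less_5 corner_def)

section \<open>Assembly of the array\<close>

locale block_array =
  fixes a b :: nat
begin

definition N :: int where "N = int (a + b)"
definition T :: int where "T = 25 + 20 * N + 16 * int (a * b)"
text \<open>The offsets lay the ranges end to end: small values from 6, the pairs around
  \<open>z\<^sub>1\<close> and then \<open>z\<^sub>2\<close>, reaching \<open>2 * N\<close> beyond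
  each gap of four on both sides, the correcting values from \<open>q\<close>, the squares from
  \<open>r\<close> up to \<open>T - 12\<close>.\<close>

definition z\<^sub>1 :: int where "z\<^sub>1 = 6 + 6 * N"
definition z\<^sub>2 :: int where "z\<^sub>2 = 10 + 10 * N"
definition q :: int where "q = 14 + 12 * N"
definition r :: int where "r = 14 + 20 * N"

text \<open>Strips right of the corner have numbers below \<open>b\<close>, and the transposed ones
  continue from \<open>b\<close>, so each number below \<open>N\<close> is used once. Squares are
  numbered row by row.\<close>

definition entry :: "nat \<Rightarrow> nat \<Rightarrow> int" where
  "entry i j =
    (if i < 5 then
       if j < 5 then corner z\<^sub>1 z\<^sub>2 T ! i ! j
       else strip z\<^sub>1 z\<^sub>2 q (int ((j - 5) div 4)) ! i ! ((j - 5) mod 4)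
     else
       if j < 5 then strip z\<^sub>1 z\<^sub>2 q (int (b + (i - 5) div 4)) ! j ! ((i - 5) mod 4)
       else square (r + 16 * int ((i - 5) div 4 * b + (j - 5) div 4)) ! ((i - 5) mod 4) ! ((j - 5) mod 4))"

lemma entry_corner: "i < 5 \<Longrightarrow> j < 5 \<Longrightarrow> entry i j = corner z\<^sub>1 z\<^sub>2 T ! i ! j"
  by (simp add: entry_def)

lemma entry_right:
  "i < 5 \<Longrightarrow> c < 4 \<Longrightarrow> entry i (5 + 4 * k + c) = strip z\<^sub>1 z\<^sub>2 q (int k) ! i ! c"
  by (simp add: entry_def)

lemma entry_below:
  "j < 5 \<Longrightarrow> c < 4 \<Longrightarrow> entry (5 + 4 * k + c) j = strip z\<^sub>1 z\<^sub>2 q (int (b + k)) ! j ! c"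
  by (simp add: entry_def)

lemma entry_square:
  "c < 4 \<Longrightarrow> d < 4 \<Longrightarrow>
    entry (5 + 4 * k + c) (5 + 4 * l + d) = square (r + 16 * int (k * b + l)) ! c ! d"
  by (simp add: entry_def)

lemma T_eq: "T = int ((5 + 4 * a) * (5 + 4 * b))"
  by (simp add: T_def N_def algebra_simps)

lemma index_cases:
  fixes i :: nat
  obtains "i < 5" | k c where "i = 5 + 4 * k + c" "c < 4"
proof (cases "i < 5")
  case False
  then have "i = 5 + 4 * ((i - 5) div 4) + (i - 5) mod 4" by simp
  then show thesis using that(2) by (meson mod_less_divisor zero_less_numeral)
qed (use that in simp)

text \<open>A row below the corner crosses a transposed strip, that is, a column of
  \<open>strip\<close>, and then squares. Only the corner can contribute a nonzero sum.\<close>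

lemma row_sum: "(\<Sum>j<5 + 4 * b. entry i j) = (if i = 2 then - (2 * T + 1) else 0)"
  by (cases i rule: index_cases)
    (simp_all add: sum_corner_blocks entry_corner entry_right entry_below entry_square
      corner_row_sum strip_row_sum strip_column_sum square_row_sum)

lemma column_sum: "(\<Sum>i<5 + 4 * a. entry i j) = (if j = 2 then - (2 * T + 1) else 0)"
  by (cases j rule: index_cases)
    (simp_all add: sum_corner_blocks entry_corner entry_right entry_below entry_square
      corner_column_sum strip_row_sum strip_column_sum square_column_sum)

section \<open>Every value from 1 to \<open>T\<close> occurs\<close>

definition occurring :: "int set" where
  "occurring = (\<lambda>(i, j). \<bar>entry i j\<bar>) ` ({..<5 + 4 * a} \<times> {..<5 + 4 * b})"

lemma occurringI: "i < 5 + 4 * a \<Longrightarrow> j < 5 + 4 * b \<Longrightarrow> \<bar>entry i j\<bar> \<in> occurring"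
  unfolding occurring_def by force

lemma corner_in_occurring: "i < 5 \<Longrightarrow> j < 5 \<Longrightarrow> \<bar>corner z\<^sub>1 z\<^sub>2 T ! i ! j\<bar> \<in> occurring"
  using occurringI[of i j] by (simp add: entry_corner)

lemma strip_in_occurring:
  assumes "0 \<le> k" "k < N" "i < 5" "c < 4"
  shows "\<bar>strip z\<^sub>1 z\<^sub>2 q k ! i ! c\<bar> \<in> occurring"
proof -
  obtain l where l: "k = int l" using assms(1) nonneg_int_cases by blast
  show ?thesis
  proof (cases "l < b")
    case True
    then show ?thesis using occurringI[of i "5 + 4 * l + c"] assms l by (simp add: entry_right)
  next
    case False
    then show ?thesis
      using occurringI[of "5 + 4 * (l - b) + c" i] assms l by (simp add: entry_below N_def)
  qed
qed

text \<open>Division by \<open>b\<close> with remainder inverts the numbering of the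
  squares.\<close>

lemma square_in_occurring:
  assumes "p < a * b" "c < 4" "d < 4"
  shows "\<bar>square (r + 16 * int p) ! c ! d\<bar> \<in> occurring"
proof -
  have "p div b < a" using assms(1) by (simp add: less_mult_imp_div_less)
  moreover have "p mod b < b" using assms(1) by (cases b) auto
  ultimately show ?thesis
    using occurringI[of "5 + 4 * (p div b) + c" "5 + 4 * (p mod b) + d"] assms
    by (simp add: entry_square)
qed

lemmas block_defs = T_def z\<^sub>1_def z\<^sub>2_def q_def r_def

lemma N_nonneg: "N \<ge> 0"
  by (simp add: N_def)

lemma corner_values:
  "{1..5} \<union> {z\<^sub>1..z\<^sub>1 + 3} \<union> {z\<^sub>2..z\<^sub>2 + 3} \<union> {T - 11..T} \<subseteq> occurring"
proof -
  have T: "T \<ge> 25" and z: "z\<^sub>1 \<ge> 0" "z\<^sub>2 \<ge> 0"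
    using N_nonneg by (simp_all add: block_defs)
  have "{1, 2, 3, 4, 5, z\<^sub>1, z\<^sub>1 + 1, z\<^sub>1 + 2, z\<^sub>1 + 3, z\<^sub>2, z\<^sub>2 + 1, z\<^sub>2 + 2, z\<^sub>2 + 3,
      T - 11, T - 10, T - 9, T - 8, T - 7, T - 6, T - 5, T - 4, T - 3, T - 2, T - 1, T} \<subseteq> occurring"
    using T z
      corner_in_occurring[of 0 0] corner_in_occurring[of 0 1] corner_in_occurring[of 0 2]
      corner_in_occurring[of 0 3] corner_in_occurring[of 0 4]
      corner_in_occurring[of 1 0] corner_in_occurring[of 1 1] corner_in_occurring[of 1 2]
      corner_in_occurring[of 1 3] corner_in_occurring[of 1 4]
      corner_in_occurring[of 2 0] corner_in_occurring[of 2 1] corner_in_occurring[of 2 2]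
      corner_in_occurring[of 2 3] corner_in_occurring[of 2 4]
      corner_in_occurring[of 3 0] corner_in_occurring[of 3 1] corner_in_occurring[of 3 2]
      corner_in_occurring[of 3 3] corner_in_occurring[of 3 4]
      corner_in_occurring[of 4 0] corner_in_occurring[of 4 1] corner_in_occurring[of 4 2]
      corner_in_occurring[of 4 3] corner_in_occurring[of 4 4]
    by (simp add: corner_def abs_if add.commute split: if_splits)
  moreover have "x \<in> {z, z + 1, z + 2, z + 3}" if "x \<in> {z..z + 3}" for x z :: int
    using that by auto
  moreover have "x \<in> {1, 2, 3, 4, 5}" if "x \<in> {1..5}" for x :: int
    using that by auto
  moreover have "x \<in> {T - 11, T - 10, T - 9, T - 8, T - 7, T - 6, T - 5, T - 4, T - 3, T - 2, T - 1, T}"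
    if "x \<in> {T - 11..T}" for x :: int
    using that by (smt (verit) insert_iff atLeastAtMost_iff)
  ultimately show ?thesis by fast
qed

lemma strip_small_values: "{6..<6 + 4 * N} \<subseteq> occurring"
proof
  fix x assume x: "x \<in> {6..<6 + 4 * N}"
  define k where "k = (x - 6) div 4"
  have k: "0 \<le> k" "k < N" using x by (auto simp: k_def)
  have "x \<in> {6 + 4 * k, 7 + 4 * k, 8 + 4 * k, 9 + 4 * k}" unfolding k_def insert_iff empty_iff by presburger
  then show "x \<in> occurring"
    using k strip_in_occurring[of k 0 0] strip_in_occurring[of k 0 1]
      strip_in_occurring[of k 0 2] strip_in_occurring[of k 0 3]
    by (auto simp: strip_def add.commute)
qed

lemma strip_pair_values:
  assumes "x \<in> {z - 2 * N..<z} \<union> {z + 4..<z + 4 + 2 * N}" and z: "z = z\<^sub>1 \<or> z = z\<^sub>2"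
  shows "x \<in> occurring"
proof -
  \<comment> \<open>\<open>t\<close> counts outward from the gap on either side; each strip takes
    two consecutive steps, so \<open>t div 2\<close> is its number.\<close>
  define t where "t = (if x < z then z - 1 - x else x - z - 4)"
  define k where "k = t div 2"
  have k: "0 \<le> k" "k < N" using assms(1) by (auto simp: k_def t_def)
  have t: "t = 2 * k \<or> t = 2 * k + 1" unfolding k_def by presburger
  \<comment> \<open>Makes the lowest value \<open>z - 2 - 2 * k\<close> nonnegative, so that the
    absolute values resolve.\<close>
  have large: "z\<^sub>1 \<ge> 2 + 2 * k" "z\<^sub>2 \<ge> 2 + 2 * k" using k by (auto simp: block_defs)
  have "x \<in> {z - 1 - 2 * k, z - 2 - 2 * k, z + 4 + 2 * k, z + 5 + 2 * k}"
    using t by (auto simp: t_def split: if_splits)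
  moreover have "{z - 1 - 2 * k, z - 2 - 2 * k, z + 4 + 2 * k, z + 5 + 2 * k} \<subseteq> occurring"
    if "z = z\<^sub>1 \<or> z = z\<^sub>2" for z
    using that k large
      strip_in_occurring[of k 1 0] strip_in_occurring[of k 1 1]
      strip_in_occurring[of k 1 2] strip_in_occurring[of k 1 3]
      strip_in_occurring[of k 2 0] strip_in_occurring[of k 2 1]
      strip_in_occurring[of k 2 2] strip_in_occurring[of k 2 3]
    by (elim disjE) (simp_all add: strip_def abs_of_nonneg abs_of_nonpos algebra_simps)
  ultimately show ?thesis using z by blast
qed

lemma strip_shift_values: "{q..<q + 8 * N} \<subseteq> occurring"
proof
  fix x assume x: "x \<in> {q..<q + 8 * N}"
  define k where "k = (x - q) div 8"
  have k: "0 \<le> k" "k < N" using x by (auto simp: k_def)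
  have q: "q \<ge> 0" using N_nonneg by (simp add: q_def)
  have "x = q + 8 * k + (x - q) mod 8" by (simp add: k_def)
  moreover have "(x - q) mod 8 \<in> {0, 1, 2, 3, 4, 5, 6, 7}" by auto
  ultimately have "x \<in> {q + 8 * k, q + 8 * k + 1, q + 8 * k + 2, q + 8 * k + 3,
      q + 8 * k + 4, q + 8 * k + 5, q + 8 * k + 6, q + 8 * k + 7}"
    by auto
  then show "x \<in> occurring"
    using k q
      strip_in_occurring[of k 3 0] strip_in_occurring[of k 3 1]
      strip_in_occurring[of k 3 2] strip_in_occurring[of k 3 3]
      strip_in_occurring[of k 4 0] strip_in_occurring[of k 4 1]
      strip_in_occurring[of k 4 2] strip_in_occurring[of k 4 3]
    by (auto simp: strip_def abs_of_nonneg abs_of_nonpos algebra_simps)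
qed

lemma abs_square_nth:
  assumes "s \<ge> 0" "c < 4" "d < 4"
  shows "\<bar>square s ! c ! d\<bar> = s + int (4 * c + d)"
  using less_4_cases[OF assms(2)] less_4_cases[OF assms(3)] assms(1)
  by (elim disjE) (simp_all add: square_def)

lemma square_values: "{r..<r + 16 * int (a * b)} \<subseteq> occurring"
proof
  fix x assume x: "x \<in> {r..<r + 16 * int (a * b)}"
  define t where "t = nat (x - r)"
  have t: "x = r + int t" "t < 16 * (a * b)" using x by (simp_all add: t_def nat_less_iff)
  define p where "p = t div 16"
  define c where "c = t mod 16 div 4"
  define d where "d = t mod 16 mod 4"
  have p: "p < a * b" using t(2) by (auto simp: p_def)
  have cd: "c < 4" "d < 4" by (auto simp: c_def d_def)
  have "t = 16 * p + (4 * c + d)" unfolding p_def c_def d_def by (simp only: mult_div_mod_eq)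
  then have "x = (r + 16 * int p) + int (4 * c + d)" using t(1) by simp
  moreover have "r \<ge> 0" using N_nonneg by (simp add: r_def)
  ultimately show "x \<in> occurring"
    using square_in_occurring[OF p cd] abs_square_nth[OF _ cd, of "r + 16 * int p"] by simp
qed

lemma occurring_cover: "{1..T} \<subseteq> occurring"
proof
  fix x assume "x \<in> {1..T}"
  then consider "x \<in> {1..5} \<union> {z\<^sub>1..z\<^sub>1 + 3} \<union> {z\<^sub>2..z\<^sub>2 + 3} \<union> {T - 11..T}"
    | "x \<in> {6..<6 + 4 * N}"
    | "x \<in> {z\<^sub>1 - 2 * N..<z\<^sub>1} \<union> {z\<^sub>1 + 4..<z\<^sub>1 + 4 + 2 * N}"
    | "x \<in> {z\<^sub>2 - 2 * N..<z\<^sub>2} \<union> {z\<^sub>2 + 4..<z\<^sub>2 + 4 + 2 * N}"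
    | "x \<in> {q..<q + 8 * N}"
    | "x \<in> {r..<r + 16 * int (a * b)}"
    \<comment> \<open>The ranges tile \<open>{1..T}\<close>; their endpoints are linear in
      \<open>N\<close> and the product of \<open>a\<close> and \<open>b\<close>.\<close>
    by (simp add: block_defs) linarith
  then show "x \<in> occurring"
    using corner_values strip_small_values strip_pair_values strip_shift_values square_values
    by cases blast+
qed

section \<open>Conclusion for all admissible sizes\<close>

theorem heffter_array_entry: "heffter_array (5 + 4 * a) (5 + 4 * b) entry"
proof (rule heffter_arrayI)
  show "{1..int ((5 + 4 * a) * (5 + 4 * b))} \<subseteq> (\<lambda>(i, j). \<bar>entry i j\<bar>) ` ({..<5 + 4 * a} \<times> {..<5 + 4 * b})"
    using occurring_cover unfolding occurring_def T_eq .
  \<comment> \<open>The exceptional line sum of the corner is exactly minus the modulus.\<close>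
  have M: "int (2 * (5 + 4 * a) * (5 + 4 * b) + 1) = 2 * T + 1"
    by (simp add: T_eq algebra_simps)
  show "[(\<Sum>j<5 + 4 * b. entry i j) = 0] (mod int (2 * (5 + 4 * a) * (5 + 4 * b) + 1))" for i
    unfolding row_sum M by (simp only: cong_0_iff dvd_minus_iff dvd_refl dvd_0_right split: if_split) simp
  show "[(\<Sum>i<5 + 4 * a. entry i j) = 0] (mod int (2 * (5 + 4 * a) * (5 + 4 * b) + 1))" for j
    unfolding column_sum M by (simp only: cong_0_iff dvd_minus_iff dvd_refl dvd_0_right split: if_split) simp
qed

end

lemma cong_1_mod_4E:
  fixes m :: nat
  assumes "m \<ge> 5" "[m = 1] (mod 4)"
  obtains a where "m = 5 + 4 * a"
proof
  have "m = 4 * (m div 4) + 1"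
    using assms(2) mult_div_mod_eq[of 4 m] by (simp add: cong_def)
  \<comment> \<open>As \<open>m\<close> is at least 5, \<open>m div 4\<close> is positive and the
    subtraction is exact.\<close>
  then show "m = 5 + 4 * (m div 4 - 1)" using assms(1) by linarith
qed

theorem theorem10:
  fixes m n :: nat
  assumes "m \<ge> 9" and "n \<ge> 9"
    and "[m = 1] (mod 4)" and "[n = 1] (mod 4)"
  shows "\<exists>A. heffter_array m n A"
proof -
  have "m \<ge> 5" "n \<ge> 5" using assms by simp_all
  then obtain a b where "m = 5 + 4 * a" "n = 5 + 4 * b"
    using assms cong_1_mod_4E by metis
  then show ?thesis using block_array.heffter_array_entry by blast
qed

end
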